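(* Let $\theta=\{\theta_k\}_{k\in\mathbb{N}_+}$ be a sequence of real numbers with $\sum_{k=1}^\infty|\theta_k|=1$, and let $p^{\theta}$ be the associated linear transition kernel on $G=\{-1,+1\}$, $$p^{\theta}(g\mid \mathbf{w}_{-\infty}^{-1})=\frac12+\frac g2\sum_{k=1}^\infty\theta_k w_{-k}.$$ Suppose that a) either $\theta_k\ge 0$ for all $k\in\mathbb{N}_+$, b) or $\theta_k\le 0$ for $k$ odd and $\theta_k\ge 0$ for $k$ even. Then uniqueness does not hold for $p^{\theta}$, i.e. it is not true that $|\mathcal{G}(p^{\theta})|=1$.
   Context: $\mathbb{N}_+=\{1,2,\dots\}$ and $G=\{-1,+1\}$. For a history $\mathbf{w}_{-\infty}^{-1}=(w_{-1},w_{-2},\dots)\in G^{-\mathbb{N}_+}$ and $g\in G$, $p^\theta(g\mid\mathbf{w}_{-\infty}^{-1})$ is given by the formula in the claim; it is a probability measure in $g$. A $G$-valued process $\mathbf{X}=\{X_n,n\in\mathbb{Z}\}$, defined on an arbitrary probability space, is compatible with $p^\theta$ if for every $g\in G$ and every $n\in\mathbb{Z}$, almost surely $P(X_n=g\mid \mathbf{X}_{-\infty}^{n-1})=p^\theta(g\mid\mathbf{X}_{-\infty}^{n-1})$, where $\mathbf{X}_{-\infty}^{n-1}=(X_{n-1},X_{n-2},\dots)$ (so $X_{n-k}$ plays the role of $w_{-k}$). $\mathcal{G}(p^\theta)$ denotes the set of laws on $G^{\mathbb{Z}}$ of processes compatible with $p^\theta$. Uniqueness holds for $p^\theta$ when $|\mathcal{G}(p^\theta)|=1$.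 *)

theory Defs
  imports "HOL-Probability.Probability"
begin

definition spins :: "int set" where
  "spins = {-1, 1}"

text \<open>A history is a function \<open>w\<close> on the positive integers, with \<open>w k\<close> standing for
  \<open>w\<^sub>-\<^sub>k\<close>; as an element of an extensional product it is undefined at the index 0.\<close>

definition history_space :: "(nat \<Rightarrow> int) measure" where
  "history_space = PiM {1..} (\<lambda>_. count_space spins)"

definition config_space :: "(int \<Rightarrow> int) measure" where
  "config_space = PiM UNIV (\<lambda>_. count_space spins)"

text \<open>The series over \<open>k \<ge> 1\<close> is reindexed from 0; the value \<open>\<theta> 0\<close> is never used.\<close>

definition linear_kernel :: "(nat \<Rightarrow> real) \<Rightarrow> int \<Rightarrow> (nat \<Rightarrow> int) \<Rightarrow> real" where
  "linear_kernel \<theta> g w = 1 / 2 + of_int g / 2 * (\<Sum>k. \<theta> (Suc k) * of_int (w (Suc k)))"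

definition past :: "(int \<Rightarrow> 'a \<Rightarrow> int) \<Rightarrow> int \<Rightarrow> 'a \<Rightarrow> nat \<Rightarrow> int" where
  "past X n \<omega> = (\<lambda>k\<in>{1..}. X (n - int k) \<omega>)"

definition past_algebra :: "'a measure \<Rightarrow> (int \<Rightarrow> 'a \<Rightarrow> int) \<Rightarrow> int \<Rightarrow> 'a measure" where
  "past_algebra M X n = vimage_algebra (space M) (past X n) history_space"

definition compatible :: "(int \<Rightarrow> (nat \<Rightarrow> int) \<Rightarrow> real) \<Rightarrow> 'a measure \<Rightarrow> (int \<Rightarrow> 'a \<Rightarrow> int) \<Rightarrow> bool" where
  "compatible p M X \<longleftrightarrow>
     prob_space M \<and>
     (\<forall>n. X n \<in> measurable M (count_space spins)) \<and>
     (\<forall>g\<in>spins. \<forall>n. AE \<omega> in M.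
        real_cond_exp M (past_algebra M X n) (indicator {\<omega>' \<in> space M. X n \<omega>' = g}) \<omega>
          = p g (past X n \<omega>))"

definition process_law :: "'a measure \<Rightarrow> (int \<Rightarrow> 'a \<Rightarrow> int) \<Rightarrow> (int \<Rightarrow> int) measure" where
  "process_law M X = distr M config_space (\<lambda>\<omega> n. X n \<omega>)"

text \<open>A set comprehension cannot range over probability spaces of all types, so the sample spaces
  are taken over the type of configurations. By \<open>process_law_in_compatible_laws\<close> below, processes
  on sample spaces of any other type have their laws in this set as well.\<close>

definition compatible_laws :: "(int \<Rightarrow> (nat \<Rightarrow> int) \<Rightarrow> real) \<Rightarrow> (int \<Rightarrow> int) measure set" where
  "compatible_laws p =
     {process_law M X | (M :: (int \<Rightarrow> int) measure) X. compatible p M X}"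

definition uniqueness_holds :: "(int \<Rightarrow> (nat \<Rightarrow> int) \<Rightarrow> real) \<Rightarrow> bool" where
  "uniqueness_holds p \<longleftrightarrow> card (compatible_laws p) = 1"

lemma measurable_path:
  assumes "\<And>n. X n \<in> measurable M (count_space spins)"
  shows "(\<lambda>\<omega> n. X n \<omega>) \<in> measurable M config_space"
  unfolding config_space_def using assms by (intro measurable_PiM_single') (auto simp: measurable_def)

lemma measurable_past:
  assumes "\<And>n. X n \<in> measurable M (count_space spins)"
  shows "past X n \<in> measurable M history_space"
  unfolding history_space_def past_def[abs_def]
  using assms by (intro measurable_restrict) auto

lemma past_algebra_subalgebra:
  assumes "\<And>n. X n \<in> measurable M (count_space spins)"
  shows "subalgebra M (past_algebra M X n)"
proof -
  have past: "past X n \<in> measurable M history_space"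
    by (rule measurable_past[OF assms])
  then have "past X n \<in> space M \<rightarrow> space history_space"
    by (rule measurable_space[THEN funcsetI])
  with past show ?thesis
    by (auto simp: subalgebra_def past_algebra_def sets_vimage_algebra2)
qed

lemma measurable_past_algebra:
  assumes "\<And>n. X n \<in> measurable M (count_space spins)" "f \<in> borel_measurable history_space"
  shows "(\<lambda>\<omega>. f (past X n \<omega>)) \<in> borel_measurable (past_algebra M X n)"
proof -
  have "past X n \<in> measurable (past_algebra M X n) history_space"
    unfolding past_algebra_def
    using measurable_space[OF measurable_past[where X = X and n = n, OF assms(1)]]
    by (intro measurable_vimage_algebra1) auto
  then show ?thesis
    using assms(2) by (rule measurable_compose)
qed

lemma compatible_process_law:
  fixes M :: "'a measure"
  assumes comp: "compatible p M X"
    and p: "\<And>g. g \<in> spins \<Longrightarrow> p g \<in> borel_measurable history_space"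
  shows "compatible p (process_law M X) (\<lambda>n x. x n)"
proof -
  define Y where "Y = (\<lambda>\<omega> n. X n \<omega>)"
  define N where "N = process_law M X"
  define C :: "int \<Rightarrow> (int \<Rightarrow> int) \<Rightarrow> int" where "C = (\<lambda>n x. x n)"
  interpret M: prob_space M using comp by (simp add: compatible_def)
  have X: "\<And>n. X n \<in> measurable M (count_space spins)" using comp by (simp add: compatible_def)
  have Y: "Y \<in> measurable M config_space" unfolding Y_def by (rule measurable_path[OF X])
  have N: "N = distr M config_space Y" by (simp add: N_def process_law_def Y_def)
  interpret N: prob_space N unfolding N by (rule M.prob_space_distr[OF Y])
  have C: "C n \<in> measurable N (count_space spins)" for n
    unfolding N C_def config_space_def by simp
  have CY: "C n (Y \<omega>) = X n \<omega>" for n \<omega> by (simp add: C_def Y_def)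
  have pastY: "past C n (Y \<omega>) = past X n \<omega>" for n \<omega> by (simp add: past_def C_def Y_def)
  have "AE x in N. real_cond_exp N (past_algebra N C n) (indicator {x' \<in> space N. C n x' = g}) x
          = p g (past C n x)" if g: "g \<in> spins" for g n
  proof -
    let ?F = "past_algebra N C n" and ?E = "past_algebra M X n"
    let ?f = "indicator {x' \<in> space N. C n x' = g} :: _ \<Rightarrow> real"
    let ?h = "indicator {\<omega>' \<in> space M. X n \<omega>' = g} :: _ \<Rightarrow> real"
    have subF: "subalgebra N ?F" by (rule past_algebra_subalgebra[OF C])
    have subE: "subalgebra M ?E" by (rule past_algebra_subalgebra[OF X])
    interpret F: finite_measure_subalgebra N ?F by standard (rule subF)
    interpret E: finite_measure_subalgebra M ?E by standard (rule subE)
    have fm: "{x' \<in> space N. C n x' = g} \<in> sets N"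
      using measurable_sets[OF C, of "{g}" n] g by (simp add: vimage_def Int_def conj_commute)
    have hm: "{\<omega>' \<in> space M. X n \<omega>' = g} \<in> sets M"
      using measurable_sets[OF X, of "{g}" n] g by (simp add: vimage_def Int_def conj_commute)
    have f_int: "integrable N ?f" using fm N.emeasure_finite by (simp add: less_top[symmetric])
    have h_int: "integrable M ?h" using hm M.emeasure_finite by (simp add: less_top[symmetric])
    have AE: "AE \<omega> in M. real_cond_exp M ?E ?h \<omega> = p g (past X n \<omega>)"
      using comp g by (simp add: compatible_def)
    have pC: "(\<lambda>x. p g (past C n x)) \<in> borel_measurable ?F"
      by (rule measurable_past_algebra[OF C p[OF g]])
    have pCN: "(\<lambda>x. p g (past C n x)) \<in> borel_measurable N"
      by (rule measurable_from_subalg[OF subF pC])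
    have pXM: "(\<lambda>\<omega>. p g (past X n \<omega>)) \<in> borel_measurable M"
      by (rule measurable_from_subalg[OF subE measurable_past_algebra[OF X p[OF g]]])
    have pX_int: "integrable M (\<lambda>\<omega>. p g (past X n \<omega>))"
      using E.real_cond_exp_int(1)[OF h_int] AE pXM
      by (subst integrable_cong_AE[where g = "real_cond_exp M ?E ?h"]) auto
    have pC_int: "integrable N (\<lambda>x. p g (past C n x))"
      using pX_int pCN unfolding N by (subst integrable_distr_eq[OF Y]) (auto simp: pastY)
    show ?thesis
    proof (rule F.real_cond_exp_charact[OF _ f_int pC_int pC])
      fix A assume A: "A \<in> sets ?F"
      then have AN: "A \<in> sets N" using subF by (auto simp: subalgebra_def)
      have "past C n \<in> space N \<rightarrow> space history_space"
        using measurable_space[OF measurable_past[where X = C and n = n, OF C]] by auto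
      with A obtain B where B: "B \<in> sets history_space" "A = past C n -` B \<inter> space N"
        by (auto simp: past_algebra_def sets_vimage_algebra2)
      let ?A = "past X n -` B \<inter> space M"
      have AE': "?A \<in> sets ?E"
        using B(1) by (auto simp: past_algebra_def intro: in_vimage_algebra)
      then have AM: "?A \<in> sets M" using subE by (auto simp: subalgebra_def)
      have ind: "indicator A (Y \<omega>) = (indicator ?A \<omega> :: real)" if "\<omega> \<in> space M" for \<omega>
        using that measurable_space[OF Y that] by (auto simp: B(2) pastY indicator_def N)
      have fh: "indicator {x' \<in> space config_space. C n x' = g} (Y \<omega>) = ?h \<omega>"
        if "\<omega> \<in> space M" for \<omega>
        using that measurable_space[OF Y that] by (auto simp: CY indicator_def)
      have "set_lebesgue_integral N A ?f = set_lebesgue_integral M ?A ?h"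
        unfolding set_lebesgue_integral_def using AN fm unfolding N
        by (subst integral_distr[OF Y])
          (auto intro!: Bochner_Integration.integral_cong simp: ind fh)
      also have "\<dots> = set_lebesgue_integral M ?A (real_cond_exp M ?E ?h)"
        by (rule E.real_cond_exp_intA[OF h_int AE'])
      also have "\<dots> = set_lebesgue_integral M ?A (\<lambda>\<omega>. p g (past X n \<omega>))"
        using AE AM pXM borel_measurable_integrable[OF E.real_cond_exp_int(1)[OF h_int]]
        by (intro set_lebesgue_integral_cong_AE) auto
      also have "\<dots> = set_lebesgue_integral N A (\<lambda>x. p g (past C n x))"
        unfolding set_lebesgue_integral_def using AN pCN unfolding N
        by (subst integral_distr[OF Y])
          (auto intro!: Bochner_Integration.integral_cong simp: ind pastY)
      finally show "set_lebesgue_integral N A ?f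
        = set_lebesgue_integral N A (\<lambda>x. p g (past C n x))" .
    qed
  qed
  then show ?thesis
    using C N.prob_space_axioms unfolding compatible_def N_def C_def by simp
qed

lemma borel_measurable_linear_kernel:
  "linear_kernel \<theta> g \<in> borel_measurable history_space"
proof -
  have "(\<lambda>w. real_of_int (w (Suc k))) \<in> borel_measurable history_space" for k
    unfolding history_space_def
    by (rule measurable_compose[OF measurable_component_singleton[where i = "Suc k"]]) auto
  then show ?thesis
    unfolding linear_kernel_def[abs_def] by measurable
qed

lemma process_law_in_compatible_laws:
  fixes M :: "'a measure"
  assumes "compatible (linear_kernel \<theta>) M X"
  shows "process_law M X \<in> compatible_laws (linear_kernel \<theta>)"
proof -
  let ?C = "\<lambda>n (x :: int \<Rightarrow> int). x n"
  have "compatible (linear_kernel \<theta>) (process_law M X) ?C"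
    by (rule compatible_process_law[OF assms borel_measurable_linear_kernel])
  moreover have "process_law (process_law M X) ?C = process_law M X"
    unfolding process_law_def by (simp add: distr_id2)
  ultimately show ?thesis
    unfolding compatible_laws_def by (metis (mono_tags, lifting) mem_Collect_eq)
qed

end

(* A deterministic configuration x with \<Sum>k. \<theta> k * x (n - k) = x n for all n is
   compatible with the kernel, since the kernel then puts full mass on x n; both x and
   -x have this property. When the absolute values of \<theta> sum to 1, the constant
   configurations work in case a) and the alternating ones in case b), so that in each
   case the two Dirac masses are distinct compatible laws. *)

theory Submission
  imports Defs
begin

lemma spins_cases: "g \<in> spins \<longleftrightarrow> g = 1 \<or> g = -1"
  by (auto simp: spins_def)

text \<open>A one-point sample space carries the constant process with path \<open>x\<close>; its
  law is the Dirac mass, and \<open>process_law_in_compatible_laws\<close> removes the dependence on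
  the sample space.\<close>

lemma return_in_compatible_laws:
  fixes x :: "int \<Rightarrow> int"
  assumes x: "\<And>n. x n \<in> spins"
    and fixpoint: "\<And>n. (\<lambda>k. \<theta> (Suc k) * of_int (x (n - int (Suc k)))) sums of_int (x n)"
  shows "return config_space x \<in> compatible_laws (linear_kernel \<theta>)"
proof -
  define M where "M = return (count_space UNIV) ()"
  define X where "X = (\<lambda>n (_ :: unit). x n)"
  interpret prob_space M
    unfolding M_def by (rule prob_space_return) simp
  have X: "X n \<in> measurable M (count_space spins)" for n
    using x by (simp add: X_def)
  have "compatible (linear_kernel \<theta>) M X"
    unfolding compatible_def
  proof (intro conjI allI ballI prob_space_axioms X)
    fix g n
    assume g: "g \<in> spins"
    interpret F: finite_measure_subalgebra M "past_algebra M X n"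
      by standard (rule past_algebra_subalgebra[OF X])
    have ind: "indicator {\<omega>' \<in> space M. X n \<omega>' = g} = (\<lambda>_. if x n = g then 1 else 0 :: real)"
      by (auto simp: fun_eq_iff M_def X_def)
    \<comment> \<open>By \<open>fixpoint\<close> the kernel equals (1 + g * x n) / 2, and both g and
      x n are signs.\<close>
    have kernel: "linear_kernel \<theta> g (past X n \<omega>) = (if x n = g then 1 else 0)" for \<omega>
      using g x[of n] sums_unique[OF fixpoint[of n], symmetric]
      by (auto simp: linear_kernel_def past_def X_def spins_cases)
    show "AE \<omega> in M. real_cond_exp M (past_algebra M X n)
        (indicator {\<omega>' \<in> space M. X n \<omega>' = g}) \<omega> = linear_kernel \<theta> g (past X n \<omega>)"
      \<comment> \<open>The indicator is constant, hence measurable for the past, so it is its own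
        conditional expectation.\<close>
      unfolding ind kernel by (rule F.real_cond_exp_F_meas) auto
  qed
  moreover have "process_law M X = return config_space x"
    unfolding process_law_def using measurable_path[of X M, OF X]
    by (simp add: M_def X_def distr_return)
  ultimately show ?thesis
    by (metis process_law_in_compatible_laws)
qed

text \<open>The cylinder fixing coordinate \<open>n\<close> to \<open>x n\<close> has mass 1 under
  the first Dirac mass, so \<open>y\<close> must lie in it too.\<close>

lemma return_config_space_inject:
  assumes x: "\<And>n. x n \<in> spins" and eq: "return config_space x = return config_space y"
  shows "x n = y n"
proof -
  have "{\<omega> \<in> space config_space. \<omega> n = x n} \<in> sets config_space"
    using measurable_sets[OF measurable_component_singleton[of n UNIV "\<lambda>_. count_space spins"],
        of "{x n}"] x
    by (simp add: config_space_def vimage_def Int_def conj_commute)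
  then have "indicator {\<omega> \<in> space config_space. \<omega> n = x n} x
      = (indicator {\<omega> \<in> space config_space. \<omega> n = x n} y :: ennreal)"
    using eq by (metis emeasure_return)
  moreover have "x \<in> space config_space"
    using x by (auto simp: config_space_def space_PiM)
  ultimately show ?thesis
    by (auto simp: indicator_def split: if_splits)
qed

theorem theorem1:
  fixes \<theta> :: "nat \<Rightarrow> real"
  assumes "(\<lambda>k. \<bar>\<theta> (Suc k)\<bar>) sums 1"
    and "(\<forall>k\<ge>1. \<theta> k \<ge> 0) \<or> (\<forall>k\<ge>1. (odd k \<longrightarrow> \<theta> k \<le> 0) \<and> (even k \<longrightarrow> \<theta> k \<ge> 0))"
  shows "\<not> uniqueness_holds (linear_kernel \<theta>)"
proof
  \<comment> \<open>The parity expression is s^k at index k = \<open>Suc k\<close>: s = 1 serves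
    case a), s = -1 case b).\<close>
  obtain s :: int where s: "s = 1 \<or> s = -1"
    and sgn: "\<And>k. \<theta> (Suc k) * of_int (if even (Suc k) then 1 else s) = \<bar>\<theta> (Suc k)\<bar>"
  proof (cases "\<forall>k\<ge>1. \<theta> k \<ge> 0")
    case True
    then show ?thesis by (intro that[of 1]) auto
  next
    case False
    then have "(odd (Suc k) \<longrightarrow> \<theta> (Suc k) \<le> 0) \<and> (even (Suc k) \<longrightarrow> \<theta> (Suc k) \<ge> 0)" for k
      using assms(2) by (metis le_add1 plus_1_eq_Suc)
    then show ?thesis by (intro that[of "-1"]) auto
  qed
  define x where "x = (\<lambda>c n :: int. c * (if even n then 1 else s))"
  have spins: "x c n \<in> spins" if "c = 1 \<or> c = -1" for c n
    using that s by (auto simp: x_def spins_cases)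
  \<comment> \<open>Here x c n = c * s^n, and s^(n-k) = s^k * s^n because s^2 = 1.\<close>
  have shift: "x c (n - int (Suc k)) = (if even (Suc k) then 1 else s) * x c n" for c n k
    using s by (auto simp: x_def)
  have law: "return config_space (x c) \<in> compatible_laws (linear_kernel \<theta>)"
    if "c = 1 \<or> c = -1" for c
  proof (rule return_in_compatible_laws[OF spins[OF that]])
    fix n
    show "(\<lambda>k. \<theta> (Suc k) * of_int (x c (n - int (Suc k)))) sums of_int (x c n)"
      \<comment> \<open>By \<open>shift\<close> and \<open>sgn\<close> the series is that of the
        absolute values, with sum 1, scaled by \<open>x c n\<close>.\<close>
      using sums_mult2[OF assms(1), of "of_int (x c n)"]
      unfolding shift of_int_mult mult.assoc[symmetric] sgn by simp
  qed
  assume "uniqueness_holds (linear_kernel \<theta>)"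
  then obtain N where "compatible_laws (linear_kernel \<theta>) = {N}"
    unfolding uniqueness_holds_def by (meson card_1_singletonE)
  with law[of 1] law[of "-1"] have "return config_space (x 1) = return config_space (x (-1))"
    by auto
  \<comment> \<open>Index 0 is even, so the two values are 1 and -1 whatever s is.\<close>
  then have "x 1 0 = x (-1) 0"
    by (rule return_config_space_inject[rotated]) (simp add: spins)
  then show False
    by (simp add: x_def)
qed

end
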